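(* For every MV-algebra $B$, the counit of the adjunction $S_B\dashv i_B$, where $i_B\colon s\mathbb{MV}/S(B)\to\mathbb{MV}/B$ and $S_B\colon\mathbb{MV}/B\to s\mathbb{MV}/S(B)$, is an isomorphism.
   Context: An MV-algebra is a set $A$ with a binary operation $\oplus$, a unary operation $\lnot$ and a constant $0$ such that $\oplus$ is associative and commutative, $x\oplus 0=x$, $\lnot\lnot x=x$, $x\oplus\lnot 0=\lnot 0$, and $\lnot(\lnot x\oplus y)\oplus y=\lnot(\lnot y\oplus x)\oplus x$. Morphisms are the maps preserving $\oplus,\lnot,0$; $\mathbb{MV}$ is the resulting category. Put $1=\lnot 0$, $x\ominus y=\lnot(\lnot x\oplus y)$, $d(x,y)=(x\ominus y)\oplus(y\ominus x)$, and $x\le y$ iff $\lnot x\oplus y=1$. An ideal of $A$ is a subset $I\subseteq A$ containing $0$, closed under $\oplus$, and such that $x\in I$ and $y\le x$ imply $y\in I$; it is proper if $I\ne A$. For an ideal $I$, $A/I$ is the quotient of $A$ by the congruence $x\sim y\iff d(x,y)\in I$. $\mathrm{Rad}(A)$ is the intersection of all maximal (proper) ideals of $A$ (with $\mathrm{Rad}(A)=A=\{0\}$ if $A$ is the one-element algebra). $A$ is semisimple if $\mathrm{Rad}(A)=\{0\}$; $s\mathbb{MV}$ is the full subcategory of semisimple MV-algebras and $i\colon s\mathbb{MV}\hookrightarrow\mathbb{MV}$ the inclusion. Its left adjoint $S$ is given by $S(A)=A/\mathrm{Rad}(A)$, $S(f)([a])=[f(a)]$, and the unit $\eta_A\colon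 A\to S(A)$ is the quotient projection. For an MV-algebra $B$: $S_B$ sends $f\colon A\to B$ to $S(f)\colon S(A)\to S(B)$; $i_B$ sends $\varphi\colon A\to S(B)$ (with $A$ semisimple) to the projection $\varphi'\colon A'\to B$, where $A'=B\times_{S(B)}A$ is the pullback in $\mathbb{MV}$ of $\varphi$ along $\eta_B$. $S_B$ is left adjoint to $i_B$; the component of the counit at $\varphi\colon A\to S(B)$ is the morphism $S(A')\to A$ over $S(B)$ induced by the projection $A'\to A$ via the universal property of $\eta_{A'}$. *)

theory Defs
  imports Main "HOL-Library.FuncSet" "HOL-Algebra.Congruence"
begin

section \<open>MV-algebras\<close>

record 'a mv = "'a partial_object" +
  mv_add :: "'a \<Rightarrow> 'a \<Rightarrow> 'a" (infixl \<open>\<oplus>\<index>\<close> 65)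
  mv_neg :: "'a \<Rightarrow> 'a" (\<open>\<sim>\<index> _\<close> [81] 80)
  mv_zero :: "'a" (\<open>\<zero>\<index>\<close>)

locale mv_algebra =
  fixes A :: "'a mv" (structure)
  assumes add_closed: "\<lbrakk>x \<in> carrier A; y \<in> carrier A\<rbrakk> \<Longrightarrow> x \<oplus> y \<in> carrier A"
    and neg_closed: "x \<in> carrier A \<Longrightarrow> \<sim> x \<in> carrier A"
    and zero_closed: "\<zero> \<in> carrier A"
    and add_assoc: "\<lbrakk>x \<in> carrier A; y \<in> carrier A; z \<in> carrier A\<rbrakk>
          \<Longrightarrow> (x \<oplus> y) \<oplus> z = x \<oplus> (y \<oplus> z)"
    and add_comm: "\<lbrakk>x \<in> carrier A; y \<in> carrier A\<rbrakk> \<Longrightarrow> x \<oplus> y = y \<oplus> x"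
    and add_zero: "x \<in> carrier A \<Longrightarrow> x \<oplus> \<zero> = x"
    and neg_neg: "x \<in> carrier A \<Longrightarrow> \<sim> (\<sim> x) = x"
    and add_one: "x \<in> carrier A \<Longrightarrow> x \<oplus> (\<sim> \<zero>) = \<sim> \<zero>"
    and lukasiewicz: "\<lbrakk>x \<in> carrier A; y \<in> carrier A\<rbrakk>
          \<Longrightarrow> (\<sim> ((\<sim> x) \<oplus> y)) \<oplus> y = (\<sim> ((\<sim> y) \<oplus> x)) \<oplus> x"

definition mv_one :: "'a mv \<Rightarrow> 'a" (\<open>\<one>\<index>\<close>)
  where "\<one>\<^bsub>A\<^esub> = \<sim>\<^bsub>A\<^esub> \<zero>\<^bsub>A\<^esub>"

definition mv_diff :: "'a mv \<Rightarrow> 'a \<Rightarrow> 'a \<Rightarrow> 'a" (infixl \<open>\<ominus>\<index>\<close> 65)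
  where "x \<ominus>\<^bsub>A\<^esub> y = \<sim>\<^bsub>A\<^esub> ((\<sim>\<^bsub>A\<^esub> x) \<oplus>\<^bsub>A\<^esub> y)"

definition mv_dist :: "'a mv \<Rightarrow> 'a \<Rightarrow> 'a \<Rightarrow> 'a"
  where "mv_dist A x y = (x \<ominus>\<^bsub>A\<^esub> y) \<oplus>\<^bsub>A\<^esub> (y \<ominus>\<^bsub>A\<^esub> x)"

definition mv_le :: "'a mv \<Rightarrow> 'a \<Rightarrow> 'a \<Rightarrow> bool"
  where "mv_le A x y \<longleftrightarrow> (\<sim>\<^bsub>A\<^esub> x) \<oplus>\<^bsub>A\<^esub> y = \<one>\<^bsub>A\<^esub>"

text \<open>Morphisms are extensional functions, so that equality of morphisms is equality in HOL;
  accordingly they are composed with \<^const>\<open>compose\<close>.\<close>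

definition mv_hom :: "'a mv \<Rightarrow> 'b mv \<Rightarrow> ('a \<Rightarrow> 'b) set"
  where "mv_hom A B = {f \<in> carrier A \<rightarrow>\<^sub>E carrier B.
    (\<forall>x\<in>carrier A. \<forall>y\<in>carrier A. f (x \<oplus>\<^bsub>A\<^esub> y) = f x \<oplus>\<^bsub>B\<^esub> f y) \<and>
    (\<forall>x\<in>carrier A. f (\<sim>\<^bsub>A\<^esub> x) = \<sim>\<^bsub>B\<^esub> (f x)) \<and>
    f \<zero>\<^bsub>A\<^esub> = \<zero>\<^bsub>B\<^esub>}"

definition mv_id :: "'a mv \<Rightarrow> 'a \<Rightarrow> 'a"
  where "mv_id A = (\<lambda>x\<in>carrier A. x)"


section \<open>Ideals, quotients and the radical\<close>

definition mv_ideal :: "'a mv \<Rightarrow> 'a set \<Rightarrow> bool"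
  where "mv_ideal A I \<longleftrightarrow> I \<subseteq> carrier A \<and> \<zero>\<^bsub>A\<^esub> \<in> I \<and>
    (\<forall>x\<in>I. \<forall>y\<in>I. x \<oplus>\<^bsub>A\<^esub> y \<in> I) \<and>
    (\<forall>x\<in>I. \<forall>y\<in>carrier A. mv_le A y x \<longrightarrow> y \<in> I)"

definition mv_proper_ideal :: "'a mv \<Rightarrow> 'a set \<Rightarrow> bool"
  where "mv_proper_ideal A I \<longleftrightarrow> mv_ideal A I \<and> I \<noteq> carrier A"

definition mv_maximal_ideal :: "'a mv \<Rightarrow> 'a set \<Rightarrow> bool"
  where "mv_maximal_ideal A M \<longleftrightarrow> mv_proper_ideal A M \<and>
    (\<forall>I. mv_proper_ideal A I \<longrightarrow> M \<subseteq> I \<longrightarrow> I = M)"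

text \<open>The intersection is taken inside the carrier, so the radical of the one-element algebra,
  which has no maximal ideals, is the whole algebra.\<close>

definition Rad :: "'a mv \<Rightarrow> 'a set"
  where "Rad A = {x \<in> carrier A. \<forall>M. mv_maximal_ideal A M \<longrightarrow> x \<in> M}"

definition semisimple :: "'a mv \<Rightarrow> bool"
  where "semisimple A \<longleftrightarrow> Rad A = {\<zero>\<^bsub>A\<^esub>}"

definition mv_cong :: "'a mv \<Rightarrow> 'a set \<Rightarrow> ('a \<times> 'a) set"
  where "mv_cong A I = {(x, y) \<in> carrier A \<times> carrier A. mv_dist A x y \<in> I}"

text \<open>A union over representatives of the class of the result is the usual way to define an
  operation on equivalence classes: all the sets in the union coincide, the relation being a
  congruence.\<close>

definition mv_quot :: "'a mv \<Rightarrow> 'a set \<Rightarrow> 'a set mv"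
  where "mv_quot A I = \<lparr>carrier = carrier A // mv_cong A I,
    mv_add = (\<lambda>X Y. \<Union>x\<in>X. \<Union>y\<in>Y. mv_cong A I `` {x \<oplus>\<^bsub>A\<^esub> y}),
    mv_neg = (\<lambda>X. \<Union>x\<in>X. mv_cong A I `` {\<sim>\<^bsub>A\<^esub> x}),
    mv_zero = mv_cong A I `` {\<zero>\<^bsub>A\<^esub>}\<rparr>"


section \<open>The semisimple reflection\<close>

definition S_obj :: "'a mv \<Rightarrow> 'a set mv"
  where "S_obj A = mv_quot A (Rad A)"

definition eta :: "'a mv \<Rightarrow> 'a \<Rightarrow> 'a set"
  where "eta A = (\<lambda>a\<in>carrier A. mv_cong A (Rad A) `` {a})"

definition S_map :: "'a mv \<Rightarrow> 'b mv \<Rightarrow> ('a \<Rightarrow> 'b) \<Rightarrow> 'a set \<Rightarrow> 'b set"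
  where "S_map A B f = (\<lambda>X\<in>carrier (S_obj A). \<Union>a\<in>X. eta B (f a))"


section \<open>Slice categories\<close>

text \<open>An object of the slice over \<open>D\<close> is a pair consisting of an algebra and a morphism from it
  to \<open>D\<close>.\<close>

type_synonym ('a, 'd) over = "'a mv \<times> ('a \<Rightarrow> 'd)"

definition mv_slice_obj :: "'d mv \<Rightarrow> ('a, 'd) over set"
  where "mv_slice_obj D = {(A, f). mv_algebra A \<and> f \<in> mv_hom A D}"

definition smv_slice_obj :: "'d mv \<Rightarrow> ('a, 'd) over set"
  where "smv_slice_obj D = {(A, f) \<in> mv_slice_obj D. semisimple A}"

definition slice_hom :: "('a, 'd) over \<Rightarrow> ('c, 'd) over \<Rightarrow> ('a \<Rightarrow> 'c) set"
  where "slice_hom X Y = {h \<in> mv_hom (fst X) (fst Y).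
    compose (carrier (fst X)) (snd Y) h = snd X}"

text \<open>Since semisimple algebras form a full subcategory, the morphisms of their slice are those
  of \<^const>\<open>slice_hom\<close>.\<close>

definition smv_slice_iso ::
    "'d mv \<Rightarrow> ('a, 'd) over \<Rightarrow> ('c, 'd) over \<Rightarrow> ('a \<Rightarrow> 'c) \<Rightarrow> bool"
  where "smv_slice_iso D X Y h \<longleftrightarrow>
    X \<in> smv_slice_obj D \<and> Y \<in> smv_slice_obj D \<and> h \<in> slice_hom X Y \<and>
    (\<exists>k \<in> slice_hom Y X.
       compose (carrier (fst X)) k h = mv_id (fst X) \<and>
       compose (carrier (fst Y)) h k = mv_id (fst Y))"


section \<open>The functors between the slices and the counit\<close>

definition S_slice :: "'b mv \<Rightarrow> ('a, 'b) over \<Rightarrow> ('a set, 'b set) over"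
  where "S_slice B X = (case X of (A, f) \<Rightarrow> (S_obj A, S_map A B f))"

definition mv_pullback :: "'b mv \<Rightarrow> 'a mv \<Rightarrow> ('b \<Rightarrow> 'd) \<Rightarrow> ('a \<Rightarrow> 'd) \<Rightarrow> ('b \<times> 'a) mv"
  where "mv_pullback B A g f = \<lparr>carrier = {(b, a) \<in> carrier B \<times> carrier A. g b = f a},
    mv_add = (\<lambda>(b, a) (b', a'). (b \<oplus>\<^bsub>B\<^esub> b', a \<oplus>\<^bsub>A\<^esub> a')),
    mv_neg = (\<lambda>(b, a). (\<sim>\<^bsub>B\<^esub> b, \<sim>\<^bsub>A\<^esub> a)),
    mv_zero = (\<zero>\<^bsub>B\<^esub>, \<zero>\<^bsub>A\<^esub>)\<rparr>"

definition i_alg :: "'b mv \<Rightarrow> ('a, 'b set) over \<Rightarrow> ('b \<times> 'a) mv"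
  where "i_alg B X = (case X of (A, \<phi>) \<Rightarrow> mv_pullback B A (eta B) \<phi>)"

definition i_slice :: "'b mv \<Rightarrow> ('a, 'b set) over \<Rightarrow> ('b \<times> 'a, 'b) over"
  where "i_slice B X = (i_alg B X, \<lambda>p\<in>carrier (i_alg B X). fst p)"

text \<open>The component of the counit at \<open>X = (A, \<phi>)\<close> is the morphism induced by the projection
  \<open>A' \<rightarrow> A\<close> through the universal property of \<open>\<eta>\<^sub>A\<^sub>'\<close>, where \<open>A' = i_alg B X\<close>.\<close>

definition counit :: "'b mv \<Rightarrow> ('a, 'b set) over \<Rightarrow> ('b \<times> 'a) set \<Rightarrow> 'a"
  where "counit B X = (THE \<epsilon>. \<epsilon> \<in> mv_hom (S_obj (i_alg B X)) (fst X) \<and>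
    compose (carrier (i_alg B X)) \<epsilon> (eta (i_alg B X)) = (\<lambda>p\<in>carrier (i_alg B X). snd p))"

end

theory Submission
  imports Defs
begin

text \<open>Let \<open>p : A' \<rightarrow> A\<close> be the projection of the pullback. It is surjective because \<open>\<eta>\<^sub>B\<close> is, and
  everything follows from \<open>Rad A' = ker p\<close>, since then \<open>S(A') \<cong> A\<close> compatibly with the maps to
  \<open>S(B)\<close>. Maximal ideals pull back along surjections, so \<open>Rad A' \<subseteq> ker p\<close> by semisimplicity of
  \<open>A\<close>. Conversely \<open>ker p\<close> consists of the pairs \<open>(b, 0)\<close> with \<open>b \<in> Rad B\<close>. If a maximal ideal
  \<open>M\<close> omits such a pair, then \<open>(c, 1) \<in> M\<close> for some \<open>c\<close> with \<open>c \<oplus> n b = 1\<close>. Now \<open>\<eta>\<^sub>B(c) = 1\<close>, that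
  is, \<open>\<not>c \<in> Rad B\<close>, so no maximal ideal of \<open>B\<close> contains \<open>c\<close>; hence some multiple of \<open>c\<close> is
  \<open>1\<close>, and \<open>M\<close> is not proper.\<close>

section \<open>Arithmetic and order\<close>

primrec mv_mult :: "'a mv \<Rightarrow> nat \<Rightarrow> 'a \<Rightarrow> 'a" where
  "mv_mult A 0 x = \<zero>\<^bsub>A\<^esub>"
| "mv_mult A (Suc n) x = x \<oplus>\<^bsub>A\<^esub> mv_mult A n x"

context mv_algebra
begin

lemma one_closed: "\<one> \<in> carrier A"
  by (simp add: mv_one_def neg_closed zero_closed)

lemma diff_closed: "\<lbrakk>x \<in> carrier A; y \<in> carrier A\<rbrakk> \<Longrightarrow> x \<ominus> y \<in> carrier A"
  by (simp add: mv_diff_def neg_closed add_closed)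

lemma dist_closed: "\<lbrakk>x \<in> carrier A; y \<in> carrier A\<rbrakk> \<Longrightarrow> mv_dist A x y \<in> carrier A"
  by (simp add: mv_dist_def diff_closed add_closed)

lemma mult_closed: "x \<in> carrier A \<Longrightarrow> mv_mult A n x \<in> carrier A"
  by (induction n) (simp_all add: zero_closed add_closed)

lemmas closed = add_closed neg_closed zero_closed one_closed diff_closed dist_closed mult_closed

lemma add_left_comm:
  "\<lbrakk>x \<in> carrier A; y \<in> carrier A; z \<in> carrier A\<rbrakk> \<Longrightarrow> x \<oplus> (y \<oplus> z) = y \<oplus> (x \<oplus> z)"
  by (metis add_assoc add_comm)

lemmas ac = add_assoc add_comm add_left_comm

lemma zero_add: "x \<in> carrier A \<Longrightarrow> \<zero> \<oplus> x = x"
  by (metis add_comm add_zero zero_closed)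

lemma neg_zero: "\<sim> \<zero> = \<one>" and neg_one: "\<sim> \<one> = \<zero>"
  by (simp_all add: mv_one_def neg_neg zero_closed)

lemma add_one': "x \<in> carrier A \<Longrightarrow> x \<oplus> \<one> = \<one>"
  by (simp add: mv_one_def add_one)

lemma one_add: "x \<in> carrier A \<Longrightarrow> \<one> \<oplus> x = \<one>"
  by (metis add_comm add_one' one_closed)

text \<open>The Lukasiewicz axiom at \<open>\<one>\<close> and \<open>x\<close>: its left side
  simplifies to \<open>\<sim> x \<oplus> x\<close>, and its right side has the summand
  \<open>\<one>\<close>.\<close>

lemma neg_add_self: "x \<in> carrier A \<Longrightarrow> \<sim> x \<oplus> x = \<one>"
  using lukasiewicz[of \<one> x] by (simp add: closed neg_one zero_add add_one' neg_closed)

lemma add_neg_self: "x \<in> carrier A \<Longrightarrow> x \<oplus> \<sim> x = \<one>"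
  by (metis add_comm neg_add_self neg_closed)

section \<open>The natural order and truncated difference\<close>

lemma le_iff_add:
  assumes "x \<in> carrier A" "y \<in> carrier A"
  shows "mv_le A x y \<longleftrightarrow> (\<exists>z\<in>carrier A. y = x \<oplus> z)"
proof
  assume "mv_le A x y"
  \<comment> \<open>The witness is \<open>y \<ominus> x\<close>: since \<open>\<sim> \<one>\<close>
    is zero, \<open>y\<close> equals the left side of the Lukasiewicz axiom, whose right side adds
    \<open>\<sim> (\<sim> y \<oplus> x)\<close> to \<open>x\<close>.\<close>
  then have "y = \<sim> (\<sim> x \<oplus> y) \<oplus> y"
    using assms by (simp add: mv_le_def neg_one zero_add)
  also have "\<dots> = x \<oplus> \<sim> (\<sim> y \<oplus> x)"
    using assms lukasiewicz[OF assms] add_comm[OF assms(1), of "\<sim> (\<sim> y \<oplus> x)"]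
    by (simp add: closed)
  finally show "\<exists>z\<in>carrier A. y = x \<oplus> z"
    using neg_closed[OF add_closed[OF neg_closed[OF assms(2)] assms(1)]] by blast
next
  assume "\<exists>z\<in>carrier A. y = x \<oplus> z"
  then obtain z where z: "z \<in> carrier A" "y = x \<oplus> z" by blast
  then have "\<sim> x \<oplus> y = (\<sim> x \<oplus> x) \<oplus> z"
    using assms by (simp add: add_assoc closed)
  then show "mv_le A x y"
    using assms z by (simp add: mv_le_def neg_add_self one_add)
qed

lemma le_refl: "x \<in> carrier A \<Longrightarrow> mv_le A x x"
  by (simp add: mv_le_def neg_add_self)

lemma le_add1: "\<lbrakk>x \<in> carrier A; y \<in> carrier A\<rbrakk> \<Longrightarrow> mv_le A x (x \<oplus> y)"
  using le_iff_add[of x "x \<oplus> y"] closed(1) by blast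

lemma le_trans:
  "\<lbrakk>mv_le A x y; mv_le A y z; x \<in> carrier A; y \<in> carrier A; z \<in> carrier A\<rbrakk> \<Longrightarrow> mv_le A x z"
  by (metis le_iff_add add_assoc add_closed)

text \<open>Under both inequalities the two sides of the Lukasiewicz axiom collapse to
  \<open>y\<close> and \<open>x\<close>.\<close>

lemma le_antisym:
  "\<lbrakk>mv_le A x y; mv_le A y x; x \<in> carrier A; y \<in> carrier A\<rbrakk> \<Longrightarrow> x = y"
  using lukasiewicz[of x y] by (simp add: mv_le_def neg_one zero_add)

lemma le_one: "x \<in> carrier A \<Longrightarrow> mv_le A x \<one>"
  by (simp add: mv_le_def add_one' closed)

lemma zero_le: "x \<in> carrier A \<Longrightarrow> mv_le A \<zero> x"
  by (simp add: mv_le_def neg_zero one_add)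

lemma add_mono:
  assumes "mv_le A x y" "mv_le A u v"
    "x \<in> carrier A" "y \<in> carrier A" "u \<in> carrier A" "v \<in> carrier A"
  shows "mv_le A (x \<oplus> u) (y \<oplus> v)"
proof -
  obtain z w where "z \<in> carrier A" "y = x \<oplus> z" "w \<in> carrier A" "v = u \<oplus> w"
    using assms le_iff_add by metis
  moreover from this have "y \<oplus> v = (x \<oplus> u) \<oplus> (z \<oplus> w)"
    using assms by (simp add: ac closed)
  ultimately show ?thesis
    using assms by (simp add: le_add1 closed)
qed

text \<open>Residuation, the source of the estimates on differences below: both inequalities unfold
  to \<open>\<sim> x \<oplus> (y \<oplus> w) = \<one>\<close>.\<close>

lemma diff_le_iff:
  assumes "x \<in> carrier A" "y \<in> carrier A" "w \<in> carrier A"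
  shows "mv_le A (x \<ominus> y) w \<longleftrightarrow> mv_le A x (y \<oplus> w)"
  using assms by (simp add: mv_le_def mv_diff_def neg_neg closed add_assoc)

lemma le_add_diff: "\<lbrakk>x \<in> carrier A; y \<in> carrier A\<rbrakk> \<Longrightarrow> mv_le A x (y \<oplus> (x \<ominus> y))"
  using diff_le_iff[of x y "x \<ominus> y"] le_refl[of "x \<ominus> y"] diff_closed by simp

text \<open>By residuation it suffices to bound \<open>x\<close> by \<open>z\<close> plus the right
  side, which follows by chaining two instances of \<open>le_add_diff\<close>.\<close>

lemma diff_triangle:
  assumes "x \<in> carrier A" "y \<in> carrier A" "z \<in> carrier A"
  shows "mv_le A (x \<ominus> z) ((x \<ominus> y) \<oplus> (y \<ominus> z))"
proof -
  have "mv_le A (y \<oplus> (x \<ominus> y)) (z \<oplus> (y \<ominus> z) \<oplus> (x \<ominus> y))"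
    using assms by (intro add_mono le_add_diff le_refl closed)
  then have "mv_le A x (z \<oplus> (y \<ominus> z) \<oplus> (x \<ominus> y))"
    by (rule le_trans[OF le_add_diff, rotated 2]) (use assms in \<open>simp_all add: closed\<close>)
  also have "z \<oplus> (y \<ominus> z) \<oplus> (x \<ominus> y) = z \<oplus> ((x \<ominus> y) \<oplus> (y \<ominus> z))"
    using assms by (simp add: ac closed)
  finally show ?thesis
    using assms by (simp add: diff_le_iff closed)
qed

lemma diff_add_add_le:
  assumes "x \<in> carrier A" "y \<in> carrier A" "u \<in> carrier A" "v \<in> carrier A"
  shows "mv_le A ((x \<oplus> u) \<ominus> (y \<oplus> v)) ((x \<ominus> y) \<oplus> (u \<ominus> v))"
proof -
  have "mv_le A (x \<oplus> u) ((y \<oplus> (x \<ominus> y)) \<oplus> (v \<oplus> (u \<ominus> v)))"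
    using assms by (intro add_mono le_add_diff closed)
  also have "(y \<oplus> (x \<ominus> y)) \<oplus> (v \<oplus> (u \<ominus> v)) = (y \<oplus> v) \<oplus> ((x \<ominus> y) \<oplus> (u \<ominus> v))"
    using assms by (simp add: ac closed)
  finally show ?thesis
    using assms by (simp add: diff_le_iff closed)
qed

section \<open>The distance\<close>

lemma dist_self: "x \<in> carrier A \<Longrightarrow> mv_dist A x x = \<zero>"
  by (simp add: mv_dist_def mv_diff_def neg_add_self neg_one add_zero closed)

lemma dist_commute: "\<lbrakk>x \<in> carrier A; y \<in> carrier A\<rbrakk> \<Longrightarrow> mv_dist A x y = mv_dist A y x"
  by (simp add: mv_dist_def add_comm closed)

lemma dist_neg: "\<lbrakk>x \<in> carrier A; y \<in> carrier A\<rbrakk> \<Longrightarrow> mv_dist A (\<sim> x) (\<sim> y) = mv_dist A x y"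
  by (simp add: mv_dist_def mv_diff_def neg_neg add_comm closed)

lemma dist_zero: "x \<in> carrier A \<Longrightarrow> mv_dist A x \<zero> = x"
  by (simp add: mv_dist_def mv_diff_def neg_neg neg_zero neg_one add_zero one_add closed)

text \<open>Gives transitivity of the congruence, as \<open>dist_add_add_le\<close> gives its
  compatibility with sums. Each adds up two estimates on differences.\<close>

lemma dist_triangle:
  assumes "x \<in> carrier A" "y \<in> carrier A" "z \<in> carrier A"
  shows "mv_le A (mv_dist A x z) (mv_dist A x y \<oplus> mv_dist A y z)"
proof -
  have "mv_le A (mv_dist A x z) (((x \<ominus> y) \<oplus> (y \<ominus> z)) \<oplus> ((z \<ominus> y) \<oplus> (y \<ominus> x)))"
    unfolding mv_dist_def using assms by (intro add_mono diff_triangle closed)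
  also have "((x \<ominus> y) \<oplus> (y \<ominus> z)) \<oplus> ((z \<ominus> y) \<oplus> (y \<ominus> x)) = mv_dist A x y \<oplus> mv_dist A y z"
    unfolding mv_dist_def using assms by (simp add: ac closed)
  finally show ?thesis .
qed

lemma dist_add_add_le:
  assumes "x \<in> carrier A" "y \<in> carrier A" "u \<in> carrier A" "v \<in> carrier A"
  shows "mv_le A (mv_dist A (x \<oplus> u) (y \<oplus> v)) (mv_dist A x y \<oplus> mv_dist A u v)"
proof -
  have "mv_le A (mv_dist A (x \<oplus> u) (y \<oplus> v))
      (((x \<ominus> y) \<oplus> (u \<ominus> v)) \<oplus> ((y \<ominus> x) \<oplus> (v \<ominus> u)))"
    unfolding mv_dist_def using assms by (intro add_mono diff_add_add_le closed)
  also have "((x \<ominus> y) \<oplus> (u \<ominus> v)) \<oplus> ((y \<ominus> x) \<oplus> (v \<ominus> u)) = mv_dist A x y \<oplus> mv_dist A u v"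
    unfolding mv_dist_def using assms by (simp add: ac closed)
  finally show ?thesis .
qed

lemma dist_eq_zero_iff:
  assumes "x \<in> carrier A" "y \<in> carrier A"
  shows "mv_dist A x y = \<zero> \<longleftrightarrow> x = y"
proof
  assume d: "mv_dist A x y = \<zero>"
  have "mv_le A x y" if "mv_dist A x y = \<zero>" "x \<in> carrier A" "y \<in> carrier A" for x y
  proof -
    \<comment> \<open>A summand lies below the sum, which is zero here; residuation then gives
      \<open>x\<close> below \<open>y \<oplus> \<zero>\<close>.\<close>
    have "mv_le A (x \<ominus> y) \<zero>"
      using that le_add1[of "x \<ominus> y" "y \<ominus> x"] by (simp add: mv_dist_def closed)
    then show ?thesis
      using that by (simp add: diff_le_iff add_zero closed)
  qed
  then show "x = y"
    using d assms dist_commute le_antisym by metis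
qed (simp add: dist_self assms)

lemma mult_add: "x \<in> carrier A \<Longrightarrow> mv_mult A (m + n) x = mv_mult A m x \<oplus> mv_mult A n x"
  by (induction m) (simp_all add: zero_add add_assoc closed)

lemma mult_zero: "mv_mult A n \<zero> = \<zero>"
  by (induction n) (simp_all add: add_zero closed)


section \<open>Ideals\<close>

lemma ideal_subset: "mv_ideal A I \<Longrightarrow> x \<in> I \<Longrightarrow> x \<in> carrier A"
  by (auto simp: mv_ideal_def)

lemma ideal_zero: "mv_ideal A I \<Longrightarrow> \<zero> \<in> I"
  by (simp add: mv_ideal_def)

lemma ideal_add: "mv_ideal A I \<Longrightarrow> x \<in> I \<Longrightarrow> y \<in> I \<Longrightarrow> x \<oplus> y \<in> I"
  by (simp add: mv_ideal_def)

lemma ideal_le: "mv_ideal A I \<Longrightarrow> x \<in> I \<Longrightarrow> mv_le A y x \<Longrightarrow> y \<in> carrier A \<Longrightarrow> y \<in> I"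
  by (simp add: mv_ideal_def)

lemma ideal_mult: "mv_ideal A I \<Longrightarrow> x \<in> I \<Longrightarrow> mv_mult A n x \<in> I"
  by (induction n) (simp_all add: ideal_zero ideal_add)

text \<open>Since \<open>\<one>\<close> is the top element and ideals are downward closed, an ideal
  containing it is the whole algebra.\<close>

lemma proper_ideal_iff: "mv_proper_ideal A I \<longleftrightarrow> mv_ideal A I \<and> \<one> \<notin> I"
proof -
  have "I = carrier A" if "mv_ideal A I" "\<one> \<in> I"
    using that ideal_le[OF that le_one] ideal_subset[OF that(1)] by blast
  then show ?thesis
    using one_closed by (auto simp: mv_proper_ideal_def)
qed

lemma zero_ideal: "mv_ideal A {\<zero>}"
  by (auto simp: mv_ideal_def closed add_zero intro: le_antisym zero_le)

lemma Rad_ideal: "mv_ideal A (Rad A)"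
  unfolding mv_ideal_def Rad_def
  by (auto simp: closed mv_maximal_ideal_def mv_proper_ideal_def
      intro: ideal_zero ideal_add ideal_le)

text \<open>For an ideal \<open>I\<close> and \<open>x\<close> in the carrier this is the ideal
  generated by \<open>I\<close> and \<open>x\<close>. The explicit form turns membership of
  \<open>\<one>\<close> into an equation.\<close>

definition adjoin :: "'a set \<Rightarrow> 'a \<Rightarrow> 'a set" where
  "adjoin I x = {y \<in> carrier A. \<exists>m\<in>I. \<exists>n. mv_le A y (m \<oplus> mv_mult A n x)}"

lemma adjoin_ideal:
  assumes I: "mv_ideal A I" and x: "x \<in> carrier A"
  shows "mv_ideal A (adjoin I x)"
  unfolding mv_ideal_def
proof (intro conjI ballI impI)
  show "adjoin I x \<subseteq> carrier A"
    by (auto simp: adjoin_def)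
  show "\<zero> \<in> adjoin I x"
    using ideal_zero[OF I] x by (auto simp: adjoin_def intro!: bexI[of _ \<zero>] zero_le closed)
next
  fix y z assume "y \<in> adjoin I x" "z \<in> adjoin I x"
  then obtain m k n l where y: "y \<in> carrier A" "m \<in> I" "mv_le A y (m \<oplus> mv_mult A k x)"
    and z: "z \<in> carrier A" "n \<in> I" "mv_le A z (n \<oplus> mv_mult A l x)"
    unfolding adjoin_def by blast
  have mn: "m \<in> carrier A" "n \<in> carrier A"
    using y z ideal_subset[OF I] by auto
  have "mv_le A (y \<oplus> z) ((m \<oplus> mv_mult A k x) \<oplus> (n \<oplus> mv_mult A l x))"
    using x y z mn by (intro add_mono closed)
  also have "(m \<oplus> mv_mult A k x) \<oplus> (n \<oplus> mv_mult A l x) = (m \<oplus> n) \<oplus> mv_mult A (k + l) x"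
    using x mn by (simp add: mult_add ac closed)
  finally show "y \<oplus> z \<in> adjoin I x"
    using y z ideal_add[OF I] by (auto simp: adjoin_def closed)
next
  fix y z assume "y \<in> adjoin I x" and z: "z \<in> carrier A" "mv_le A z y"
  then obtain m k where y: "y \<in> carrier A" "m \<in> I" "mv_le A y (m \<oplus> mv_mult A k x)"
    unfolding adjoin_def by blast
  then have "mv_le A z (m \<oplus> mv_mult A k x)"
    using le_trans[OF z(2)] z x ideal_subset[OF I] by (simp add: closed)
  with y z show "z \<in> adjoin I x"
    by (auto simp: adjoin_def)
qed

lemma subset_adjoin: "mv_ideal A I \<Longrightarrow> x \<in> carrier A \<Longrightarrow> I \<subseteq> adjoin I x"
  by (auto simp: adjoin_def ideal_subset intro!: bexI exI[of _ 0] le_add1 zero_closed)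

lemma self_in_adjoin:
  assumes "mv_ideal A I" "x \<in> carrier A"
  shows "x \<in> adjoin I x"
proof -
  have "\<zero> \<oplus> mv_mult A 1 x = x"
    using assms by (simp add: zero_add add_zero closed)
  then show ?thesis
    using assms le_refl[of x] ideal_zero[of I]
    by (auto simp: adjoin_def intro!: bexI[of _ \<zero>] exI[of _ 1])
qed

lemma one_in_adjoin_iff:
  assumes "mv_ideal A I" "x \<in> carrier A"
  shows "\<one> \<in> adjoin I x \<longleftrightarrow> (\<exists>m\<in>I. \<exists>n. m \<oplus> mv_mult A n x = \<one>)"
proof -
  have "mv_le A \<one> y \<longleftrightarrow> y = \<one>" if "y \<in> carrier A" for y
    using that by (simp add: mv_le_def neg_one zero_add)
  then show ?thesis
    using assms ideal_subset by (simp add: adjoin_def closed)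
qed

text \<open>An element outside a maximal \<open>M\<close> generates with it a strictly larger ideal,
  which must contain \<open>\<one>\<close>. Conversely, an ideal that contains \<open>M\<close> and
  an element outside it contains the given sum \<open>\<one>\<close>. The criterion speaks of
  elements only, so it can be moved along morphisms.\<close>

lemma maximal_ideal_iff:
  "mv_maximal_ideal A M \<longleftrightarrow> mv_proper_ideal A M \<and>
    (\<forall>x\<in>carrier A - M. \<exists>m\<in>M. \<exists>n. m \<oplus> mv_mult A n x = \<one>)"
proof (intro iffI conjI ballI)
  assume M: "mv_maximal_ideal A M"
  then show proper: "mv_proper_ideal A M"
    by (simp add: mv_maximal_ideal_def)
  then have ideal: "mv_ideal A M"
    by (simp add: mv_proper_ideal_def)
  fix x assume x: "x \<in> carrier A - M"
  then have "adjoin M x \<noteq> M"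
    using self_in_adjoin ideal by blast
  then have "\<not> mv_proper_ideal A (adjoin M x)"
    using M subset_adjoin ideal x unfolding mv_maximal_ideal_def by blast
  then show "\<exists>m\<in>M. \<exists>n. m \<oplus> mv_mult A n x = \<one>"
    using adjoin_ideal one_in_adjoin_iff ideal x by (simp add: proper_ideal_iff)
next
  assume *: "mv_proper_ideal A M \<and> (\<forall>x\<in>carrier A - M. \<exists>m\<in>M. \<exists>n. m \<oplus> mv_mult A n x = \<one>)"
  show "mv_maximal_ideal A M"
    unfolding mv_maximal_ideal_def
  proof (intro conjI allI impI)
    fix I assume I: "mv_proper_ideal A I" "M \<subseteq> I"
    then have ideal: "mv_ideal A I"
      by (simp add: mv_proper_ideal_def)
    have "x \<in> M" if x: "x \<in> I" for x
    proof (rule ccontr)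
      assume "x \<notin> M"
      then obtain m n where mn: "m \<in> M" "m \<oplus> mv_mult A n x = \<one>"
        using * ideal_subset[OF ideal x] by blast
      then have "m \<oplus> mv_mult A n x \<in> I"
        using I x mn by (intro ideal_add[OF ideal] ideal_mult[OF ideal]) auto
      then show False
        using I mn by (simp add: proper_ideal_iff)
    qed
    with I show "I = M" by blast
  qed (use * in blast)
qed

text \<open>Zorn's lemma: the union of a nonempty chain of ideals is an ideal, and it is proper
  because no member contains \<open>\<one>\<close>.\<close>

lemma maximal_ideal_exists:
  assumes "mv_proper_ideal A I"
  shows "\<exists>M. mv_maximal_ideal A M \<and> I \<subseteq> M"
proof -
  let ?P = "{J. mv_proper_ideal A J \<and> I \<subseteq> J}"
  have "\<exists>M\<in>?P. \<forall>J\<in>?P. M \<subseteq> J \<longrightarrow> J = M"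
  proof (rule subset_Zorn_nonempty)
    show "?P \<noteq> {}" using assms by blast
  next
    fix C assume C: "C \<noteq> {}" "subset.chain ?P C"
    then have CP: "\<And>J. J \<in> C \<Longrightarrow> mv_ideal A J \<and> \<one> \<notin> J \<and> I \<subseteq> J"
      by (auto simp: subset.chain_def proper_ideal_iff)
    have "mv_ideal A (\<Union>C)"
      unfolding mv_ideal_def
    proof (intro conjI ballI impI)
      show "\<Union>C \<subseteq> carrier A" using CP ideal_subset by blast
      show "\<zero> \<in> \<Union>C" using C CP ideal_zero by blast
    next
      fix x y assume "x \<in> \<Union>C" "y \<in> \<Union>C"
      then obtain J K where JK: "J \<in> C" "x \<in> J" "K \<in> C" "y \<in> K" by blast
      \<comment> \<open>Members of a chain are comparable, so both summands lie in the larger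
        one.\<close>
      then have "J \<subseteq> K \<or> K \<subseteq> J"
        using C by (simp add: subset_chain_def)
      then show "x \<oplus> y \<in> \<Union>C"
        using JK CP ideal_add by blast
    next
      fix x y assume "x \<in> \<Union>C" "y \<in> carrier A" "mv_le A y x"
      then show "y \<in> \<Union>C" using CP ideal_le by blast
    qed
    then show "\<Union>C \<in> ?P"
      using C CP by (auto simp: proper_ideal_iff)
  qed
  then obtain M where M: "mv_proper_ideal A M" "I \<subseteq> M"
    and max: "\<And>J. mv_proper_ideal A J \<Longrightarrow> I \<subseteq> J \<Longrightarrow> M \<subseteq> J \<Longrightarrow> J = M"
    by auto
  then have "mv_maximal_ideal A M"
    unfolding mv_maximal_ideal_def by (meson subset_trans)
  with M show ?thesis by blast
qed

text \<open>Otherwise the ideal generated by \<open>x\<close> is proper and extends to a maximal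
  ideal, which also contains \<open>\<sim> x\<close> and hence
  \<open>x \<oplus> \<sim> x = \<one>\<close>.\<close>

lemma Rad_neg_mult_eq_one:
  assumes "x \<in> carrier A" "\<sim> x \<in> Rad A"
  shows "\<exists>n. mv_mult A n x = \<one>"
proof (rule ccontr)
  assume no: "\<nexists>n. mv_mult A n x = \<one>"
  have ideal: "mv_ideal A (adjoin {\<zero>} x)"
    using adjoin_ideal zero_ideal assms by blast
  have "\<one> \<notin> adjoin {\<zero>} x"
    using no assms by (simp add: one_in_adjoin_iff zero_ideal zero_add closed)
  then obtain M where M: "mv_maximal_ideal A M" "adjoin {\<zero>} x \<subseteq> M"
    using maximal_ideal_exists ideal proper_ideal_iff by blast
  then have "x \<in> M" "\<sim> x \<in> M" "mv_ideal A M" "\<one> \<notin> M"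
    using assms self_in_adjoin zero_ideal
    by (auto simp: Rad_def mv_maximal_ideal_def proper_ideal_iff)
  then show False
    using ideal_add[of M x "\<sim> x"] add_neg_self assms by simp
qed


section \<open>Quotients\<close>

lemma cong_iff:
  "(x, y) \<in> mv_cong A I \<longleftrightarrow> x \<in> carrier A \<and> y \<in> carrier A \<and> mv_dist A x y \<in> I"
  by (auto simp: mv_cong_def)

lemma cong_equiv:
  assumes "mv_ideal A I"
  shows "equiv (carrier A) (mv_cong A I)"
proof (rule equivI)
  show "mv_cong A I \<subseteq> carrier A \<times> carrier A"
    by (auto simp: mv_cong_def)
  show "refl_on (carrier A) (mv_cong A I)"
    using assms by (auto simp: refl_on_def cong_iff dist_self ideal_zero)
  show "sym (mv_cong A I)"
    by (auto simp: sym_def cong_iff dist_commute)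
  show "trans (mv_cong A I)"
  proof (rule transI)
    fix x y z assume "(x, y) \<in> mv_cong A I" "(y, z) \<in> mv_cong A I"
    then show "(x, z) \<in> mv_cong A I"
      using ideal_le[OF assms ideal_add[OF assms] dist_triangle[of x y z]]
      by (simp add: cong_iff closed)
  qed
qed

lemma cong_neg: "(x, y) \<in> mv_cong A I \<Longrightarrow> (\<sim> x, \<sim> y) \<in> mv_cong A I"
  by (simp add: cong_iff dist_neg closed)

lemma cong_add:
  assumes "mv_ideal A I" "(x, y) \<in> mv_cong A I" "(u, v) \<in> mv_cong A I"
  shows "(x \<oplus> u, y \<oplus> v) \<in> mv_cong A I"
  using ideal_le[OF assms(1) ideal_add[OF assms(1)] dist_add_add_le[of x y u v]] assms(2,3)
  by (simp add: cong_iff closed)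

context
  fixes I
  assumes I: "mv_ideal A I"
begin

abbreviation cls :: "'a \<Rightarrow> 'a set" where
  "cls x \<equiv> mv_cong A I `` {x}"

lemma quot_carrierE:
  assumes "X \<in> carrier (mv_quot A I)"
  obtains x where "x \<in> carrier A" "X = cls x"
  using assms by (auto simp: mv_quot_def elim: quotientE)

lemma cls_closed: "x \<in> carrier A \<Longrightarrow> cls x \<in> carrier (mv_quot A I)"
  by (simp add: mv_quot_def quotientI)

lemma cls_eq_iff:
  "\<lbrakk>x \<in> carrier A; y \<in> carrier A\<rbrakk> \<Longrightarrow> cls x = cls y \<longleftrightarrow> mv_dist A x y \<in> I"
  using eq_equiv_class_iff[OF cong_equiv[OF I]] by (simp add: cong_iff)

text \<open>Negation respects the congruence, so the sets in the union of \<open>mv_quot\<close>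
  coincide; \<open>quot_add\<close> is the binary version.\<close>

lemma quot_neg:
  assumes "x \<in> carrier A"
  shows "\<sim>\<^bsub>mv_quot A I\<^esub> cls x = cls (\<sim> x)"
proof -
  have "(\<lambda>x. cls (\<sim> x)) respects mv_cong A I"
    by (rule congruentI) (rule equiv_class_eq[OF cong_equiv[OF I] cong_neg])
  from UN_equiv_class[OF cong_equiv[OF I] this assms] show ?thesis
    by (simp add: mv_quot_def)
qed

lemma quot_add:
  assumes "x \<in> carrier A" "y \<in> carrier A"
  shows "cls x \<oplus>\<^bsub>mv_quot A I\<^esub> cls y = cls (x \<oplus> y)"
proof -
  have "(\<lambda>x y. cls (x \<oplus> y)) respects2 mv_cong A I"
    by (rule congruent2I') (rule equiv_class_eq[OF cong_equiv[OF I] cong_add[OF I]])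
  from UN_equiv_class2[OF cong_equiv[OF I] cong_equiv[OF I] this assms] show ?thesis
    by (simp add: mv_quot_def)
qed

lemma quot_zero: "\<zero>\<^bsub>mv_quot A I\<^esub> = cls \<zero>"
  by (simp add: mv_quot_def)

text \<open>On representatives each law reduces to the same law in \<open>A\<close>.\<close>

lemma quot_mv_algebra: "mv_algebra (mv_quot A I)"
proof
  show "\<zero>\<^bsub>mv_quot A I\<^esub> \<in> carrier (mv_quot A I)"
    by (simp add: quot_zero cls_closed closed)
qed ((elim quot_carrierE)?,
    simp add: quot_add quot_neg quot_zero cls_closed closed add_assoc add_zero neg_neg add_one;
    metis add_comm lukasiewicz)+

lemma cls_hom: "restrict cls (carrier A) \<in> mv_hom A (mv_quot A I)"
  by (auto simp: mv_hom_def quot_add quot_neg quot_zero cls_closed closed)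

end

end


section \<open>Morphisms\<close>

locale mv_morphism = A: mv_algebra A + B: mv_algebra B
  for A :: "'a mv" and B :: "'b mv" +
  fixes f :: "'a \<Rightarrow> 'b"
  assumes hom: "f \<in> mv_hom A B"
begin

lemma hom_closed: "x \<in> carrier A \<Longrightarrow> f x \<in> carrier B"
  using hom by (auto simp: mv_hom_def)

lemma hom_add: "\<lbrakk>x \<in> carrier A; y \<in> carrier A\<rbrakk> \<Longrightarrow> f (x \<oplus>\<^bsub>A\<^esub> y) = f x \<oplus>\<^bsub>B\<^esub> f y"
  and hom_neg: "x \<in> carrier A \<Longrightarrow> f (\<sim>\<^bsub>A\<^esub> x) = \<sim>\<^bsub>B\<^esub> f x"
  and hom_zero: "f \<zero>\<^bsub>A\<^esub> = \<zero>\<^bsub>B\<^esub>"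
  using hom by (auto simp: mv_hom_def)

lemma hom_one: "f \<one>\<^bsub>A\<^esub> = \<one>\<^bsub>B\<^esub>"
  by (simp add: mv_one_def hom_neg hom_zero A.closed)

lemma hom_dist:
  "\<lbrakk>x \<in> carrier A; y \<in> carrier A\<rbrakk> \<Longrightarrow> f (mv_dist A x y) = mv_dist B (f x) (f y)"
  by (simp add: mv_dist_def mv_diff_def hom_add hom_neg A.closed)

lemma hom_mult: "x \<in> carrier A \<Longrightarrow> f (mv_mult A n x) = mv_mult B n (f x)"
  by (induction n) (simp_all add: hom_add hom_zero A.closed)

lemma hom_le:
  "\<lbrakk>mv_le A x y; x \<in> carrier A; y \<in> carrier A\<rbrakk> \<Longrightarrow> mv_le B (f x) (f y)"
  unfolding mv_le_def by (metis A.neg_closed hom_add hom_neg hom_one)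

lemma vimage_ideal:
  assumes "mv_ideal B J"
  shows "mv_ideal A {x \<in> carrier A. f x \<in> J}"
  unfolding mv_ideal_def
  using assms by (auto simp: A.closed hom_zero hom_add B.ideal_zero B.ideal_add
      intro: B.ideal_le hom_le hom_closed)

text \<open>The elementwise criterion for \<open>N\<close> gives a witness for \<open>f x\<close>,
  which is lifted by surjectivity. The lift must be corrected, since an element over
  \<open>\<one>\<close> need not be \<open>\<one>\<close>.\<close>

lemma vimage_maximal_ideal:
  assumes surj: "f ` carrier A = carrier B" and N: "mv_maximal_ideal B N"
  shows "mv_maximal_ideal A {x \<in> carrier A. f x \<in> N}" (is "mv_maximal_ideal A ?M")
  unfolding A.maximal_ideal_iff
proof (intro conjI ballI)
  have N_ideal: "mv_ideal B N" and N_proper: "\<one>\<^bsub>B\<^esub> \<notin> N"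
    using N by (simp_all add: B.maximal_ideal_iff B.proper_ideal_iff)
  then show "mv_proper_ideal A ?M"
    by (simp add: A.proper_ideal_iff vimage_ideal hom_one)
  fix x assume "x \<in> carrier A - ?M"
  then have x: "x \<in> carrier A" "f x \<in> carrier B - N"
    using hom_closed by auto
  then obtain m' n where "m' \<in> N" and n: "m' \<oplus>\<^bsub>B\<^esub> mv_mult B n (f x) = \<one>\<^bsub>B\<^esub>"
    using N unfolding B.maximal_ideal_iff by blast
  then obtain m where m: "m \<in> carrier A" "f m = m'" "f m \<in> N"
    using surj B.ideal_subset[OF N_ideal] by (metis imageE)
  define y where "y = m \<oplus>\<^bsub>A\<^esub> mv_mult A n x"
  have y: "y \<in> carrier A"
    using x m by (simp add: y_def A.closed)
  have "f y = \<one>\<^bsub>B\<^esub>"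
    using n m x by (simp add: y_def hom_add hom_mult A.closed)
  \<comment> \<open>The correction \<open>\<sim> y\<close> maps to zero, so adding it to
    \<open>m\<close> stays in the preimage, and it completes the sum \<open>y\<close> to
    \<open>\<one>\<close>.\<close>
  then have "\<sim>\<^bsub>A\<^esub> y \<oplus>\<^bsub>A\<^esub> m \<in> ?M"
    using m y N_ideal by (simp add: hom_add hom_neg A.closed B.neg_one B.ideal_zero B.ideal_add)
  moreover have "(\<sim>\<^bsub>A\<^esub> y \<oplus>\<^bsub>A\<^esub> m) \<oplus>\<^bsub>A\<^esub> mv_mult A n x = \<sim>\<^bsub>A\<^esub> y \<oplus>\<^bsub>A\<^esub> y"
    using x m y by (simp add: A.add_assoc A.closed) (simp add: y_def)
  then have "(\<sim>\<^bsub>A\<^esub> y \<oplus>\<^bsub>A\<^esub> m) \<oplus>\<^bsub>A\<^esub> mv_mult A n x = \<one>\<^bsub>A\<^esub>"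
    using y by (simp add: A.neg_add_self)
  ultimately show "\<exists>m\<in>?M. \<exists>n. m \<oplus>\<^bsub>A\<^esub> mv_mult A n x = \<one>\<^bsub>A\<^esub>"
    by blast
qed

text \<open>The preimages of the maximal ideals of \<open>B\<close> are among the maximal ideals of
  \<open>A\<close>.\<close>

lemma hom_Rad:
  assumes "f ` carrier A = carrier B" "x \<in> Rad A"
  shows "f x \<in> Rad B"
  using assms vimage_maximal_ideal hom_closed by (auto simp: Rad_def)

lemma semisimple_of_bij_betw:
  assumes bij: "bij_betw f (carrier A) (carrier B)" and B: "semisimple B"
  shows "semisimple A"
proof -
  have "x = \<zero>\<^bsub>A\<^esub>" if "x \<in> Rad A" for x
  proof -
    have "f x = f \<zero>\<^bsub>A\<^esub>"
      using that hom_Rad bij B by (auto simp: bij_betw_def semisimple_def hom_zero)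
    then show ?thesis
      using that bij by (auto simp: bij_betw_def inj_on_def Rad_def A.closed)
  qed
  then show ?thesis
    using A.Rad_ideal A.ideal_zero by (auto simp: semisimple_def)
qed

lemma inverse_hom:
  assumes bij: "bij_betw f (carrier A) (carrier B)"
  shows "restrict (inv_into (carrier A) f) (carrier B) \<in> mv_hom B A"
proof -
  let ?g = "inv_into (carrier A) f"
  have g: "?g y \<in> carrier A" "f (?g y) = y" if "y \<in> carrier B" for y
    using bij that by (auto simp: bij_betw_def inv_into_into f_inv_into_f)
  \<comment> \<open>Values of the inverse are recognised by their images, so each law follows by
    applying \<open>f\<close>.\<close>
  have eq: "?g y = x" if "x \<in> carrier A" "f x = y" for x y
    using bij that by (auto simp: bij_betw_def)
  show ?thesis
    using g by (auto simp: mv_hom_def A.closed B.closed hom_add hom_neg hom_zero intro!: eq)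
qed

text \<open>A morphism carries distances to distances, and a distance vanishes only between equal
  elements.\<close>

lemma cong_Rad_iff:
  assumes "Rad A = {x \<in> carrier A. f x = \<zero>\<^bsub>B\<^esub>}"
  shows "(x, y) \<in> mv_cong A (Rad A) \<longleftrightarrow> x \<in> carrier A \<and> y \<in> carrier A \<and> f x = f y"
proof -
  have "mv_dist A x y \<in> Rad A \<longleftrightarrow> f x = f y" if "x \<in> carrier A" "y \<in> carrier A"
    unfolding assms using that
    by (simp add: A.dist_closed hom_dist hom_closed B.dist_eq_zero_iff)
  then show ?thesis
    by (auto simp: A.cong_iff)
qed

end

lemma comp_hom:
  assumes "mv_algebra A" "f \<in> mv_hom A B" "g \<in> mv_hom B C"
  shows "compose (carrier A) g f \<in> mv_hom A C"
  using assms by (auto simp: mv_hom_def compose_def mv_algebra.closed PiE_iff)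


section \<open>The semisimple reflection\<close>

context mv_algebra
begin

lemma S_obj_mv_algebra: "mv_algebra (S_obj A)"
  by (simp add: S_obj_def quot_mv_algebra Rad_ideal)

lemma eta_morphism: "mv_morphism A (S_obj A) (eta A)"
  using cls_hom[OF Rad_ideal] S_obj_mv_algebra
  by (simp add: mv_morphism_def mv_morphism_axioms_def mv_algebra_axioms eta_def S_obj_def)

lemma eta_surj: "eta A ` carrier A = carrier (S_obj A)"
  by (auto simp: eta_def S_obj_def mv_quot_def quotient_def)

lemma eta_eq_iff:
  "\<lbrakk>x \<in> carrier A; y \<in> carrier A\<rbrakk> \<Longrightarrow> eta A x = eta A y \<longleftrightarrow> (x, y) \<in> mv_cong A (Rad A)"
  by (simp add: eta_def cls_eq_iff Rad_ideal cong_iff)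

lemma eta_eq_zero_iff: "x \<in> carrier A \<Longrightarrow> eta A x = \<zero>\<^bsub>S_obj A\<^esub> \<longleftrightarrow> x \<in> Rad A"
  using eta_eq_iff[of x \<zero>] mv_morphism.hom_zero[OF eta_morphism]
  by (simp add: cong_iff closed dist_zero)

text \<open>Together with \<open>eta_subset\<close> this serves to evaluate the union over a class
  in \<open>S_map\<close>.\<close>

lemma mem_eta: "x \<in> carrier A \<Longrightarrow> x \<in> eta A x"
  by (simp add: eta_def cong_iff dist_self Rad_ideal ideal_zero)

lemma eta_subset: "\<lbrakk>x \<in> carrier A; y \<in> eta A x\<rbrakk> \<Longrightarrow> y \<in> carrier A \<and> eta A y = eta A x"
  by (metis (no_types, lifting) Image_singleton_iff cong_iff
      equiv_class_eq[OF cong_equiv[OF Rad_ideal]] eta_def restrict_apply')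

end

text \<open>\<open>ker f = Rad A\<close> makes the classes of \<open>S(A)\<close> the fibres of \<open>f\<close>.\<close>

locale reflecting_morphism = mv_morphism A B f
  for A :: "'a mv" and B :: "'b mv" and f +
  assumes surj: "f ` carrier A = carrier B"
    and kernel: "Rad A = {x \<in> carrier A. f x = \<zero>\<^bsub>B\<^esub>}"
begin

lemma eta_eq_iff_hom_eq:
  "\<lbrakk>x \<in> carrier A; y \<in> carrier A\<rbrakk> \<Longrightarrow> eta A x = eta A y \<longleftrightarrow> f x = f y"
  by (simp add: A.eta_eq_iff cong_Rad_iff[OF kernel])

text \<open>The factorisation of \<open>f\<close> through \<open>eta A\<close>. The choice of
  representative is harmless by \<open>eta_eq_iff_hom_eq\<close>.\<close>

definition induced :: "'a set \<Rightarrow> 'b" where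
  "induced = (\<lambda>X\<in>carrier (S_obj A). f (inv_into (carrier A) (eta A) X))"

lemma induced_eta:
  assumes "x \<in> carrier A"
  shows "induced (eta A x) = f x"
proof -
  have X: "eta A x \<in> eta A ` carrier A"
    using assms by blast
  then have "f (inv_into (carrier A) (eta A) (eta A x)) = f x"
    using assms by (metis eta_eq_iff_hom_eq f_inv_into_f inv_into_into)
  then show ?thesis
    using X by (simp add: induced_def A.eta_surj)
qed

lemma S_objE:
  assumes "X \<in> carrier (S_obj A)"
  obtains x where "x \<in> carrier A" "X = eta A x"
  using assms A.eta_surj by blast

lemma induced_hom: "induced \<in> mv_hom (S_obj A) B"
proof -
  interpret E: mv_morphism A "S_obj A" "eta A"
    by (rule A.eta_morphism)
  have "induced \<in> extensional (carrier (S_obj A))"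
    by (simp add: induced_def)
  then show ?thesis
    by (auto simp: mv_hom_def PiE_iff induced_eta hom_closed hom_add hom_neg hom_zero A.closed
        simp flip: E.hom_add E.hom_neg E.hom_zero elim!: S_objE)
qed

lemma induced_bij: "bij_betw induced (carrier (S_obj A)) (carrier B)"
  unfolding bij_betw_def
proof
  show "inj_on induced (carrier (S_obj A))"
    by (auto simp: inj_on_def induced_eta simp flip: eta_eq_iff_hom_eq elim!: S_objE)
  show "induced ` carrier (S_obj A) = carrier B"
    using surj by (auto simp: induced_eta image_image simp flip: A.eta_surj)
qed

text \<open>Every element of \<open>S_obj A\<close> is some \<open>eta A x\<close>, where the value
  is prescribed. This uniqueness resolves the description in \<open>counit\<close>.\<close>

lemma induced_unique:
  assumes "g \<in> mv_hom (S_obj A) B" "compose (carrier A) g (eta A) = restrict f (carrier A)"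
  shows "g = induced"
proof (rule extensionalityI)
  show "g \<in> extensional (carrier (S_obj A))"
    using assms(1) by (simp add: mv_hom_def PiE_iff)
  show "induced \<in> extensional (carrier (S_obj A))"
    by (simp add: induced_def)
  fix X assume "X \<in> carrier (S_obj A)"
  then obtain x where "x \<in> carrier A" "X = eta A x" by (rule S_objE)
  then show "g X = induced X"
    using fun_cong[OF assms(2), of x] by (simp add: compose_def induced_eta)
qed

end


section \<open>The pullback\<close>

locale pullback_over_reflection = B: mv_algebra B + A: mv_algebra A
  for B :: "'b mv" and A :: "'a mv" +
  fixes \<phi> :: "'a \<Rightarrow> 'b set"
  assumes \<phi>_hom: "\<phi> \<in> mv_hom A (S_obj B)"
    and A_semisimple: "semisimple A"
begin

sublocale SB: mv_algebra "S_obj B"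
  by (rule B.S_obj_mv_algebra)

sublocale E: mv_morphism B "S_obj B" "eta B"
  by (rule B.eta_morphism)

sublocale \<phi>: mv_morphism A "S_obj B" \<phi>
  by unfold_locales (rule \<phi>_hom)

abbreviation P :: "('b \<times> 'a) mv" where
  "P \<equiv> mv_pullback B A (eta B) \<phi>"

lemma P_carrier_iff:
  "(b, a) \<in> carrier P \<longleftrightarrow> b \<in> carrier B \<and> a \<in> carrier A \<and> eta B b = \<phi> a"
  by (simp add: mv_pullback_def)

lemma P_add: "(b, a) \<oplus>\<^bsub>P\<^esub> (b', a') = (b \<oplus>\<^bsub>B\<^esub> b', a \<oplus>\<^bsub>A\<^esub> a')"
  and P_neg: "\<sim>\<^bsub>P\<^esub> (b, a) = (\<sim>\<^bsub>B\<^esub> b, \<sim>\<^bsub>A\<^esub> a)"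
  and P_zero: "\<zero>\<^bsub>P\<^esub> = (\<zero>\<^bsub>B\<^esub>, \<zero>\<^bsub>A\<^esub>)"
  by (simp_all add: mv_pullback_def)

text \<open>The laws hold in each coordinate; closure holds because \<open>eta B\<close> and
  \<open>\<phi>\<close> are morphisms.\<close>

sublocale P: mv_algebra P
  by unfold_locales
    (auto simp: P_carrier_iff P_add P_neg P_zero B.closed A.closed E.hom_add E.hom_neg E.hom_zero
      \<phi>.hom_add \<phi>.hom_neg \<phi>.hom_zero B.add_assoc A.add_assoc B.add_zero A.add_zero
      B.neg_neg A.neg_neg B.add_one A.add_one
      intro: B.add_comm A.add_comm B.lukasiewicz A.lukasiewicz)

abbreviation fst_P :: "'b \<times> 'a \<Rightarrow> 'b" where
  "fst_P \<equiv> \<lambda>p\<in>carrier P. fst p"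

abbreviation snd_P :: "'b \<times> 'a \<Rightarrow> 'a" where
  "snd_P \<equiv> \<lambda>p\<in>carrier P. snd p"

sublocale fst: mv_morphism P B fst_P
proof unfold_locales
  show "fst_P \<in> mv_hom P B"
    using P.add_closed P.neg_closed P.zero_closed
    by (auto simp: mv_hom_def P_carrier_iff P_add P_neg P_zero)
qed

sublocale snd: mv_morphism P A snd_P
proof unfold_locales
  show "snd_P \<in> mv_hom P A"
    using P.add_closed P.neg_closed P.zero_closed
    by (auto simp: mv_hom_def P_carrier_iff P_add P_neg P_zero)
qed

lemma snd_surj: "snd_P ` carrier P = carrier A"
proof
  show "carrier A \<subseteq> snd_P ` carrier P"
  proof
    fix a assume a: "a \<in> carrier A"
    then have "\<phi> a \<in> eta B ` carrier B"
      by (simp add: \<phi>.hom_closed B.eta_surj)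
    then obtain b where "b \<in> carrier B" "eta B b = \<phi> a"
      by force
    then have "(b, a) \<in> carrier P"
      using a by (simp add: P_carrier_iff)
    then show "a \<in> snd_P ` carrier P"
      by force
  qed
qed (use snd.hom_closed in blast)

section \<open>The radical of the pullback\<close>

lemma kernel_subset_maximal_ideal:
  assumes M: "mv_maximal_ideal P M" and p: "p \<in> carrier P" "snd_P p = \<zero>\<^bsub>A\<^esub>"
  shows "p \<in> M"
proof (rule ccontr)
  have M_ideal: "mv_ideal P M" and M_proper: "\<one>\<^bsub>P\<^esub> \<notin> M"
    using M by (simp_all add: P.maximal_ideal_iff P.proper_ideal_iff)
  assume "p \<notin> M"
  then obtain m n where m: "m \<in> M" "m \<oplus>\<^bsub>P\<^esub> mv_mult P n p = \<one>\<^bsub>P\<^esub>"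
    using M p unfolding P.maximal_ideal_iff by blast
  have mP: "m \<in> carrier P"
    using m M_ideal P.ideal_subset by blast
  then obtain c a where ca: "m = (c, a)" "c \<in> carrier B" "a \<in> carrier A" "eta B c = \<phi> a"
    by (metis P_carrier_iff surj_pair)
  \<comment> \<open>Multiples of \<open>p\<close> have second coordinate zero, so \<open>m\<close>
    already has the second coordinate of the sum, namely \<open>\<one>\<close>.\<close>
  have "snd_P (m \<oplus>\<^bsub>P\<^esub> mv_mult P n p) = snd_P m"
    using mP p by (simp only: snd.hom_add snd.hom_mult P.closed)
      (simp add: A.mult_zero A.add_zero snd.hom_closed ca)
  then have "a = \<one>\<^bsub>A\<^esub>"
    using m mP ca snd.hom_one by (simp only: ) simp
  \<comment> \<open>As \<open>m\<close> lies in the pullback, \<open>eta B c\<close> is the value of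
    \<open>\<phi>\<close> at \<open>\<one>\<close>, that is, the one of
    \<open>S_obj B\<close>.\<close>
  then have "eta B (\<sim>\<^bsub>B\<^esub> c) = \<zero>\<^bsub>S_obj B\<^esub>"
    using ca by (simp add: E.hom_neg \<phi>.hom_one SB.neg_one)
  then have "\<sim>\<^bsub>B\<^esub> c \<in> Rad B"
    using ca by (simp add: B.eta_eq_zero_iff B.closed)
  then obtain k where k: "mv_mult B k c = \<one>\<^bsub>B\<^esub>"
    using B.Rad_neg_mult_eq_one ca by blast
  have mult: "mv_mult P j m = (mv_mult B j c, mv_mult A j \<one>\<^bsub>A\<^esub>)" for j
    by (induction j) (simp_all add: P_zero P_add ca \<open>a = \<one>\<^bsub>A\<^esub>\<close>)
  \<comment> \<open>One more copy of \<open>m\<close> is taken because \<open>k\<close> may be 0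
    when \<open>B\<close> is trivial, and the zeroth multiple has second coordinate zero. The first
    coordinate stays \<open>\<one>\<close>.\<close>
  have "mv_mult P (Suc k) m = \<one>\<^bsub>P\<^esub>"
    unfolding mult using ca k
    by (simp add: mv_one_def[of P] P_zero P_neg B.neg_zero A.neg_zero B.add_one' A.one_add A.closed)
  then show False
    using P.ideal_mult[OF M_ideal m(1)] M_proper by metis
qed

sublocale snd: reflecting_morphism P A snd_P
proof unfold_locales
  show "Rad P = {p \<in> carrier P. snd_P p = \<zero>\<^bsub>A\<^esub>}"
  proof (intro equalityI subsetI)
    fix p assume p: "p \<in> Rad P"
    then have "snd_P p \<in> Rad A"
      using snd.hom_Rad snd_surj by blast
    with p A_semisimple show "p \<in> {p \<in> carrier P. snd_P p = \<zero>\<^bsub>A\<^esub>}"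
      by (simp add: semisimple_def Rad_def)
  next
    fix p assume "p \<in> {p \<in> carrier P. snd_P p = \<zero>\<^bsub>A\<^esub>}"
    then show "p \<in> Rad P"
      using kernel_subset_maximal_ideal unfolding Rad_def by blast
  qed
qed (rule snd_surj)

section \<open>The counit and its inverse\<close>

sublocale SP: mv_algebra "S_obj P"
  by (rule P.S_obj_mv_algebra)

sublocale ind: mv_morphism "S_obj P" A snd.induced
  by unfold_locales (rule snd.induced_hom)

lemma counit_eq_induced: "counit B (A, \<phi>) = snd.induced"
  unfolding counit_def
proof (rule the_equality)
  have "compose (carrier P) snd.induced (eta P) = snd_P"
    by (auto simp: compose_def fun_eq_iff snd.induced_eta)
  then show "snd.induced \<in> mv_hom (S_obj (i_alg B (A, \<phi>))) (fst (A, \<phi>)) \<and>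
      compose (carrier (i_alg B (A, \<phi>))) snd.induced (eta (i_alg B (A, \<phi>))) =
        (\<lambda>p\<in>carrier (i_alg B (A, \<phi>)). snd p)"
    by (simp add: i_alg_def snd.induced_hom)
next
  fix g
  assume "g \<in> mv_hom (S_obj (i_alg B (A, \<phi>))) (fst (A, \<phi>)) \<and>
      compose (carrier (i_alg B (A, \<phi>))) g (eta (i_alg B (A, \<phi>))) =
        (\<lambda>p\<in>carrier (i_alg B (A, \<phi>)). snd p)"
  then show "g = snd.induced"
    by (intro snd.induced_unique) (simp_all add: i_alg_def)
qed

text \<open>All members of a class have the same second coordinate, and the pullback condition turns
  \<open>eta B\<close> of the first coordinate into \<open>\<phi>\<close> of the second. This places
  the counit over \<open>S_obj B\<close>.\<close>

lemma S_map_eq: "S_map P B fst_P = compose (carrier (S_obj P)) \<phi> snd.induced"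
proof (rule extensionalityI)
  fix X assume X: "X \<in> carrier (S_obj P)"
  then obtain p where p: "p \<in> carrier P" "X = eta P p" by (rule snd.S_objE)
  have "eta B (fst_P q) = \<phi> (snd_P p)" if "q \<in> X" for q
  proof -
    have q: "q \<in> carrier P" "eta P q = eta P p"
      using P.eta_subset[OF p(1)] that p(2) by blast+
    then have "snd_P q = snd_P p"
      using snd.eta_eq_iff_hom_eq[OF q(1) p(1)] by simp
    moreover have "eta B (fst_P q) = \<phi> (snd_P q)"
      using q by (cases q) (simp add: P_carrier_iff)
    ultimately show ?thesis by simp
  qed
  \<comment> \<open>The union of a constant family is its value only over a nonempty index
    set.\<close>
  moreover have "p \<in> X"
    using p P.mem_eta by simp
  ultimately have "(\<Union>q\<in>X. eta B (fst_P q)) = \<phi> (snd_P p)"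
    by blast
  then show "S_map P B fst_P X = compose (carrier (S_obj P)) \<phi> snd.induced X"
    using X p by (simp add: S_map_def compose_def snd.induced_eta)
qed (simp_all add: S_map_def)

lemma counit_iso:
  "smv_slice_iso (S_obj B) (S_slice B (i_slice B (A, \<phi>))) (A, \<phi>) (counit B (A, \<phi>))"
proof -
  let ?\<epsilon> = "snd.induced"
  let ?k = "restrict (inv_into (carrier (S_obj P)) ?\<epsilon>) (carrier A)"
  have k_eps: "compose (carrier (S_obj P)) ?k ?\<epsilon> = mv_id (S_obj P)"
    using snd.induced_bij ind.hom_closed
    by (auto simp: compose_def mv_id_def bij_betw_def fun_eq_iff)
  have eps_k: "compose (carrier A) ?\<epsilon> ?k = mv_id A"
    using snd.induced_bij
    by (auto simp: compose_def mv_id_def bij_betw_def fun_eq_iff f_inv_into_f)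
  have k_hom: "?k \<in> mv_hom A (S_obj P)"
    by (rule ind.inverse_hom[OF snd.induced_bij])
  have S_slice: "S_slice B (i_slice B (A, \<phi>)) = (S_obj P, compose (carrier (S_obj P)) \<phi> ?\<epsilon>)"
    by (simp add: S_slice_def i_slice_def i_alg_def S_map_eq)
  \<comment> \<open>Semisimplicity of \<open>S_obj P\<close> is transported from \<open>A\<close>
    along the bijective morphism \<open>?\<epsilon>\<close>.\<close>
  have source: "(S_obj P, compose (carrier (S_obj P)) \<phi> ?\<epsilon>) \<in> smv_slice_obj (S_obj B)"
    using ind.semisimple_of_bij_betw[OF snd.induced_bij A_semisimple]
      comp_hom[OF SP.mv_algebra_axioms snd.induced_hom \<phi>_hom]
    by (simp add: smv_slice_obj_def mv_slice_obj_def SP.mv_algebra_axioms)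
  have target: "(A, \<phi>) \<in> smv_slice_obj (S_obj B)"
    by (simp add: smv_slice_obj_def mv_slice_obj_def A.mv_algebra_axioms \<phi>_hom A_semisimple)
  \<comment> \<open>The inverse is a morphism of the slice: \<open>\<phi>\<close> after
    \<open>?\<epsilon>\<close> after \<open>?k\<close> is \<open>\<phi>\<close>, as
    \<open>?k\<close> is a section of \<open>?\<epsilon>\<close>.\<close>
  have "compose (carrier A) (compose (carrier (S_obj P)) \<phi> ?\<epsilon>) ?k = \<phi>"
  proof (rule extensionalityI)
    show "\<phi> \<in> extensional (carrier A)"
      using \<phi>_hom by (simp add: mv_hom_def PiE_iff)
    fix a assume a: "a \<in> carrier A"
    then have "?k a \<in> carrier (S_obj P)" "?\<epsilon> (?k a) = a"
      using k_hom fun_cong[OF eps_k, of a] by (auto simp: mv_hom_def compose_def mv_id_def)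
    then show "compose (carrier A) (compose (carrier (S_obj P)) \<phi> ?\<epsilon>) ?k a = \<phi> a"
      using a by (simp add: compose_def)
  qed simp
  then have "?k \<in> slice_hom (A, \<phi>) (S_obj P, compose (carrier (S_obj P)) \<phi> ?\<epsilon>)"
    using k_hom by (simp add: slice_hom_def)
  moreover have "?\<epsilon> \<in> slice_hom (S_obj P, compose (carrier (S_obj P)) \<phi> ?\<epsilon>) (A, \<phi>)"
    using snd.induced_hom by (simp add: slice_hom_def)
  ultimately show ?thesis
    unfolding smv_slice_iso_def S_slice counit_eq_induced
    using source target k_eps eps_k by auto
qed

end

theorem proposition5p7:
  fixes B :: "'b mv"
  assumes "mv_algebra B"
  shows "\<forall>X :: ('a, 'b set) over. X \<in> smv_slice_obj (S_obj B) \<longrightarrow>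
    smv_slice_iso (S_obj B) (S_slice B (i_slice B X)) X (counit B X)"
proof (intro allI impI)
  fix X :: "('a, 'b set) over"
  assume X: "X \<in> smv_slice_obj (S_obj B)"
  obtain A \<phi> where [simp]: "X = (A, \<phi>)" by (cases X)
  have "pullback_over_reflection B A \<phi>"
    using X assms
    by (simp add: pullback_over_reflection_def pullback_over_reflection_axioms_def
        smv_slice_obj_def mv_slice_obj_def)
  then show "smv_slice_iso (S_obj B) (S_slice B (i_slice B X)) X (counit B X)"
    by (simp add: pullback_over_reflection.counit_iso)
qed

end
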